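(* For all positive integers $m$, $\alpha$ and $n$, $$\sum_{k=0}^{n-1}(2k+1)A_k^{(\alpha)}(x)^m\equiv 0\pmod{n}$$ and $$\sum_{k=0}^{n-1}(-1)^k(2k+1)A_k^{(\alpha)}(x)^m\equiv 0\pmod{n},$$ where the congruences are between polynomials in $\mathbb{Z}[x]$, i.e. every coefficient of each left-hand side is divisible by $n$.
   Context: For a positive integer $\alpha$ and a non-negative integer $k$, the generalized Apéry polynomial is $$A_k^{(\alpha)}(x)=\sum_{j=0}^{k}\binom{k}{j}^{\alpha}\binom{k+j}{j}^{\alpha}x^j\in\mathbb{Z}[x].$$ The notation $A_k^{(\alpha)}(x)^m$ means the $m$-th power of this polynomial. *)

theory Defs
  imports "HOL-Computational_Algebra.Computational_Algebra"
begin

definition apery_poly :: "nat \<Rightarrow> nat \<Rightarrow> int poly" where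
  "apery_poly \<alpha> k =
     (\<Sum>j\<le>k. monom (int ((k choose j) ^ \<alpha> * ((k + j) choose j) ^ \<alpha>)) j)"

text \<open>Congruence in \<open>\<int>[x]\<close> modulo an integer. The library's \<open>cong\<close> requires a Euclidean
  semiring, which \<open>\<int>[x]\<close> is not.\<close>

definition poly_cong :: "int poly \<Rightarrow> int poly \<Rightarrow> nat \<Rightarrow> bool" where
  "poly_cong p q n \<longleftrightarrow> (\<forall>i. int n dvd coeff (p - q) i)"

end

theory Submission
  imports Defs
begin

text \<open>The sums are values at \<open>q = 1\<close> of \<open>q\<close>-analogues in \<open>\<int>[q][x]\<close>, so it suffices that these
  \<open>q\<close>-analogues are divisible by \<open>1 + q + \<dots> + q\<^sup>n\<^sup>-\<^sup>1\<close>, i.e. vanish at every \<open>n\<close>-th root of unity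
  \<open>z \<noteq> 1\<close>. If \<open>z\<close> has order \<open>d\<close>, then by the \<open>q\<close>-Lucas theorem and the symmetry \<open>k \<mapsto> -1 - k\<close> the
  reflection \<open>a d + r \<mapsto> a d + (d - 1 - r)\<close> preserves the \<open>q\<close>-Apery polynomials and negates the
  \<open>q\<close>-analogue of \<open>2 k + 1\<close>, so that each block of \<open>d\<close> consecutive terms sums to zero.\<close>

section \<open>Gaussian binomial coefficients\<close>

text \<open>Given by the q-Pascal recurrence instead of a quotient, so that it makes sense at roots
  of unity and is visibly an integer polynomial in \<open>q\<close>.\<close>

fun qbinomial :: "'a::comm_ring_1 \<Rightarrow> nat \<Rightarrow> nat \<Rightarrow> 'a" where
  "qbinomial q n 0 = 1"
| "qbinomial q 0 (Suc j) = 0"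
| "qbinomial q (Suc n) (Suc j) = qbinomial q n j + q ^ Suc j * qbinomial q n (Suc j)"

lemma qbinomial_eq_0: "n < j \<Longrightarrow> qbinomial q n j = 0"
  by (induction q n j rule: qbinomial.induct) auto

lemma qbinomial_self: "qbinomial q n n = 1"
  by (induction n) (auto simp: qbinomial_eq_0)

lemma qbinomial_one: "qbinomial 1 n j = of_nat (n choose j)"
  by (induction "1::'a" n j rule: qbinomial.induct) auto

text \<open>The denominators are cleared because they may vanish at roots of unity. For
  \<open>j > n\<close> both sides are zero, the right one through its factor
  \<open>i = n\<close>.\<close>

lemma qbinomial_mult_prod:
  "qbinomial q n j * (\<Prod>i<j. 1 - q ^ Suc i) = (\<Prod>i<j. 1 - q ^ (n - i))"
proof (induction q n j rule: qbinomial.induct)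
  case (2 q j)
  have "(\<Prod>i<Suc j. 1 - q ^ (0 - i)) = 0"
    by (rule prod_zero) auto
  then show ?case by simp
next
  case (3 q n j)
  let ?N = "\<Prod>i<j. 1 - q ^ (n - i)"
  have shift: "(\<Prod>i<Suc j. 1 - q ^ (Suc n - i)) = (1 - q ^ Suc n) * ?N"
    by (simp only: prod.lessThan_Suc_shift) simp
  have IH2: "qbinomial q n (Suc j) * (\<Prod>i<Suc j. 1 - q ^ Suc i) = ?N * (1 - q ^ (n - j))"
    using 3(2) by (simp only: prod.lessThan_Suc)
  have "qbinomial q (Suc n) (Suc j) * (\<Prod>i<Suc j. 1 - q ^ Suc i)
      = (qbinomial q n j * (\<Prod>i<j. 1 - q ^ Suc i)) * (1 - q ^ Suc j)
        + q ^ Suc j * (qbinomial q n (Suc j) * (\<Prod>i<Suc j. 1 - q ^ Suc i))"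
    by (simp only: qbinomial.simps prod.lessThan_Suc algebra_simps)
  also have "\<dots> = ?N * (1 - q ^ Suc j) + q ^ Suc j * (?N * (1 - q ^ (n - j)))"
    by (simp only: 3(1) IH2)
  also have "\<dots> = (1 - q ^ Suc n) * ?N"
  proof (cases "j \<le> n")
    case True
    then have "q ^ Suc n = q ^ Suc j * q ^ (n - j)"
      by (simp flip: power_add del: power_Suc)
    then show ?thesis by (simp only: algebra_simps mult_1)
  next
    case False
    then have "?N = 0" by (intro prod_zero) (auto intro!: bexI[of _ n])
    then show ?thesis by simp
  qed
  finally show ?case by (simp only: shift)
qed auto

text \<open>The right-hand side depends on \<open>k\<close> only through \<open>q\<^sup>-\<^sup>k + q\<^sup>k\<^sup>+\<^sup>1\<close>, which is invariant under
  \<open>k \<mapsto> -1 - k\<close>.\<close>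

lemma qbinomial_pair_prod:
  fixes q :: "'a::field"
  assumes "q \<noteq> 0"
  shows "inverse q ^ (k * j) * qbinomial q k j * qbinomial q (k + j) j
           * (\<Prod>i<j. 1 - q ^ Suc i)\<^sup>2
       = (\<Prod>i<j. inverse q ^ k + q ^ Suc k - inverse q ^ i - q ^ Suc i)" (is "?L = _")
proof -
  let ?D = "\<Prod>i<j. 1 - q ^ Suc i"
  have factor: "inverse q ^ k * (1 - q ^ (k - i)) * (1 - q ^ (k + Suc i))
      = inverse q ^ k + q ^ Suc k - inverse q ^ i - q ^ Suc i" if "i \<le> k" for i
  proof -
    define r where "r = k - i"
    have r: "k = i + r" using that by (simp add: r_def)
    \<comment> \<open>With \<open>a = q ^ i\<close> and \<open>b = q ^ (k - i)\<close>, the last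
      factor on the left is \<open>1 - q ^ (k + Suc i)\<close>.\<close>
    have "inverse (a * b) * (1 - b) * (1 - q * (a * b * a))
        = inverse (a * b) + q * (a * b) - inverse a - q * a" if "a \<noteq> 0" "b \<noteq> 0" for a b :: 'a
      using that by (simp add: field_simps)
    from this[of "q ^ i" "q ^ r"] show ?thesis
      using assms by (simp add: r power_add power_inverse)
  qed
  have "?L = inverse q ^ (k * j) * (qbinomial q k j * ?D) * (qbinomial q (k + j) j * ?D)"
    by (simp only: power2_eq_square mult_ac)
  also have "\<dots> = inverse q ^ (k * j) * (\<Prod>i<j. 1 - q ^ (k - i)) * (\<Prod>i<j. 1 - q ^ (k + j - i))"
    by (simp only: qbinomial_mult_prod)
  also have "(\<Prod>i<j. 1 - q ^ (k + j - i)) = (\<Prod>i<j. 1 - q ^ (k + Suc i))"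
    by (rule prod.reindex_bij_witness[of _ "\<lambda>i. j - Suc i" "\<lambda>i. j - Suc i"])
      (auto simp: Suc_diff_Suc simp del: power_Suc)
  also have "inverse q ^ (k * j) * (\<Prod>i<j. 1 - q ^ (k - i)) * (\<Prod>i<j. 1 - q ^ (k + Suc i))
      = (\<Prod>i<j. inverse q ^ k * (1 - q ^ (k - i)) * (1 - q ^ (k + Suc i)))"
    by (simp only: prod.distrib prod_constant card_lessThan power_mult)
  also have "\<dots> = (\<Prod>i<j. inverse q ^ k + q ^ Suc k - inverse q ^ i - q ^ Suc i)"
  proof (cases "j \<le> k")
    case True
    then show ?thesis by (intro prod.cong refl factor) auto
  next
    case False
    \<comment> \<open>Both products contain the factor \<open>i = k\<close>, which is zero.\<close>
    then have "(\<Prod>i<j. inverse q ^ k * (1 - q ^ (k - i)) * (1 - q ^ (k + Suc i))) = 0"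
      "(\<Prod>i<j. inverse q ^ k + q ^ Suc k - inverse q ^ i - q ^ Suc i) = 0"
      by (intro prod_zero bexI[of _ k]; simp)+
    then show ?thesis by (simp only:)
  qed
  finally show ?thesis .
qed

section \<open>A \<open>q\<close>-analogue of the sums\<close>

text \<open>For \<open>q ^ N = 1\<close> the factors \<open>q ^ ((N - k) * j)\<close> and \<open>q ^ (N - k)\<close> stand for the negative
  powers \<open>q\<^sup>-\<^sup>k\<^sup>j\<close> and \<open>q\<^sup>-\<^sup>k\<close>, which provide the symmetry under \<open>k \<mapsto> -1 - k\<close>; shifting by \<open>N\<close>
  keeps everything polynomial in \<open>q\<close> for \<open>k \<le> N\<close>.\<close>

definition q_apery_coeff :: "nat \<Rightarrow> 'a::comm_ring_1 \<Rightarrow> nat \<Rightarrow> nat \<Rightarrow> 'a" where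
  "q_apery_coeff N q k j = q ^ ((N - k) * j) * qbinomial q k j * qbinomial q (k + j) j"

definition q_apery_poly :: "nat \<Rightarrow> 'a::comm_ring_1 \<Rightarrow> nat \<Rightarrow> nat \<Rightarrow> 'a poly" where
  "q_apery_poly N q \<alpha> k = (\<Sum>j\<le>k. monom (q_apery_coeff N q k j ^ \<alpha>) j)"

definition q_weight :: "nat \<Rightarrow> 'a::comm_ring_1 \<Rightarrow> nat \<Rightarrow> 'a" where
  "q_weight N q k = q ^ (N - k) * (\<Sum>i<2 * k + 1. q ^ i)"

text \<open>The exponent \<open>k (k + 1) / 2\<close> compensates for \<open>(- 1) ^ k\<close> changing sign under
  \<open>k \<mapsto> d - 1 - k\<close> when \<open>d\<close> is even.\<close>

definition q_sign :: "'a::comm_ring_1 \<Rightarrow> nat \<Rightarrow> 'a" where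
  "q_sign q k = (- 1) ^ k * q ^ (k * (k + 1) div 2)"

text \<open>Valid beyond \<open>k\<close> too, as \<open>qbinomial q k j\<close> vanishes there;
  thus polynomials with different summation ranges can be compared coefficientwise.\<close>

lemma coeff_q_apery_poly:
  assumes "\<alpha> > 0"
  shows "coeff (q_apery_poly N q \<alpha> k) j = q_apery_coeff N q k j ^ \<alpha>"
proof (cases "j \<le> k")
  case True
  then show ?thesis by (simp add: q_apery_poly_def coeff_sum)
next
  case False
  then show ?thesis
    using assms
    by (simp add: q_apery_poly_def coeff_sum q_apery_coeff_def qbinomial_eq_0 zero_power)
qed

section \<open>Behaviour at a primitive root of unity\<close>

locale primitive_root =
  fixes z :: complex and d :: nat
  assumes d_gt_1: "d > 1"
    and power_d [simp]: "z ^ d = 1"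
    and power_neq_1: "\<And>i. 0 < i \<Longrightarrow> i < d \<Longrightarrow> z ^ i \<noteq> 1"
begin

lemma nonzero [simp]: "z \<noteq> 0"
  using power_d d_gt_1 by (metis power_0_left zero_neq_one not_one_less_zero)

lemma power_mult_d [simp]: "z ^ (d * k) = 1" "z ^ (k * d) = 1"
  by (simp add: power_mult, subst mult.commute, simp add: power_mult)

lemma power_mod: "z ^ (i mod d) = z ^ i"
proof -
  have "z ^ i = z ^ (d * (i div d) + i mod d)" by simp
  also have "\<dots> = z ^ (i mod d)" by (simp only: power_add power_mult_d mult_1)
  finally show ?thesis by simp
qed

section \<open>The q-Lucas theorem\<close>

lemma prod_nonzero:
  assumes "j < d"
  shows "(\<Prod>i<j. 1 - z ^ Suc i) \<noteq> 0"
  using assms power_neq_1 by (force simp del: power_Suc)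

text \<open>The numerator contains \<open>1 - z ^ d = 0\<close>, while the denominator is nonzero
  for \<open>j < d\<close>.\<close>

lemma qbinomial_d_eq_0:
  assumes "0 < j" "j < d"
  shows "qbinomial z d j = 0"
proof -
  have "(\<Prod>i<j. 1 - z ^ (d - i)) = 0"
    using assms by (intro prod_zero) (auto intro!: bexI[of _ 0])
  then have "qbinomial z d j * (\<Prod>i<j. 1 - z ^ Suc i) = 0"
    by (simp only: qbinomial_mult_prod)
  then show ?thesis
    using prod_nonzero[OF assms(2)] by (simp only: mult_eq_0_iff) simp
qed

text \<open>Induction by the q-Pascal recurrence, split by whether the residues of \<open>n\<close>
  and \<open>i\<close>, where \<open>j = Suc i\<close>, wrap around modulo \<open>d\<close>.\<close>

theorem qLucas:
  "qbinomial z n j = of_nat ((n div d) choose (j div d)) * qbinomial z (n mod d) (j mod d)"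
proof (induction n arbitrary: j)
  case 0
  show ?case
  proof (cases "j < d")
    case True
    then show ?thesis by simp
  next
    case False
    then have "j div d > 0" using d_gt_1 by (simp add: div_greater_zero_iff)
    moreover have "j > 0" using False d_gt_1 by linarith
    ultimately show ?thesis by (simp add: binomial_eq_0 qbinomial_eq_0)
  qed
next
  case (Suc n)
  have dpos: "d > 0" using d_gt_1 by simp
  show ?case
  proof (cases j)
    case 0
    then show ?thesis by simp
  next
    case j: (Suc i)
    define a b r s where "a = n div d" and "b = i div d" and "r = n mod d" and "s = i mod d"
    have rs: "r < d" "s < d" using dpos by (auto simp: r_def s_def)
    have zi: "z ^ Suc i = z ^ Suc s"
      by (simp add: s_def power_mod)
    have LHS: "qbinomial z (Suc n) j = of_nat (a choose b) * qbinomial z r s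
        + z ^ Suc s * (of_nat (a choose (Suc i div d)) * qbinomial z r (Suc i mod d))"
      unfolding j by (simp only: qbinomial.simps zi Suc.IH a_def b_def r_def s_def)
    have suc_i: "Suc i div d = (if Suc s = d then Suc b else b)"
      "Suc i mod d = (if Suc s = d then 0 else Suc s)"
      unfolding b_def s_def by (auto simp: div_Suc mod_Suc)
    have suc_n: "Suc n div d = (if Suc r = d then Suc a else a)"
      "Suc n mod d = (if Suc r = d then 0 else Suc r)"
      unfolding a_def r_def by (auto simp: div_Suc mod_Suc)
    have zd: "Suc s = d \<Longrightarrow> z ^ Suc s = 1" by (simp only: power_d)
    consider "Suc r \<noteq> d" "Suc s \<noteq> d" | "Suc r \<noteq> d" "Suc s = d"
      | "Suc r = d" "Suc s \<noteq> d" | "Suc r = d" "Suc s = d" by blast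
    then show ?thesis
    proof cases
      case 1
      then show ?thesis
        unfolding LHS unfolding j suc_i suc_n by (simp add: algebra_simps)
    next
      case 2
      then have "r < s" using rs by linarith
      then show ?thesis
        using 2 unfolding LHS zd[OF 2(2)] unfolding j suc_i suc_n by (simp add: qbinomial_eq_0)
    next
      case 3
      \<comment> \<open>Only \<open>n\<close> wraps: the two terms recombine, by the recurrence,
        into a coefficient of row \<open>d\<close>.\<close>
      have "qbinomial z r s + z ^ Suc s * qbinomial z r (Suc s) = qbinomial z d (Suc s)"
        by (simp flip: 3(1))
      also have "\<dots> = 0" using 3 rs by (intro qbinomial_d_eq_0) auto
      finally have "of_nat (a choose b) * (qbinomial z r s + z ^ Suc s * qbinomial z r (Suc s)) = 0"
        by simp
      then show ?thesis
        using 3 unfolding LHS unfolding j suc_i suc_n by (simp add: algebra_simps)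
    next
      case 4
      \<comment> \<open>Both wrap: what remains is Pascal's rule for the ordinary binomials in the
        quotients.\<close>
      then have "r = s" by linarith
      then have "qbinomial z r s = 1" by (simp only: qbinomial_self)
      then show ?thesis
        using 4 unfolding LHS zd[OF 4(2)] unfolding j suc_i suc_n by simp
    qed
  qed
qed

section \<open>Reflection symmetry of the summands\<close>

lemma power_minus_index:
  assumes "d dvd N" "k \<le> N"
  shows "z ^ (N - k) = inverse z ^ k"
proof -
  have "z ^ (N - k) * z ^ k = 1"
    using assms by (auto simp flip: power_add elim!: dvdE)
  then show ?thesis by (simp add: power_inverse field_simps)
qed

lemma q_apery_coeff_conv:
  assumes "d dvd N" "k \<le> N"
  shows "q_apery_coeff N z k j = inverse z ^ (k * j) * qbinomial z k j * qbinomial z (k + j) j"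
  using power_minus_index[OF assms] by (simp add: q_apery_coeff_def power_mult)

text \<open>On the right, \<open>r + s\<close> stays unreduced modulo \<open>d\<close> so that
  \<open>qbinomial_pair_prod\<close> applies.\<close>

lemma q_apery_coeff_Lucas:
  fixes k j :: nat
  defines "a \<equiv> k div d" and "b \<equiv> j div d" and "r \<equiv> k mod d" and "s \<equiv> j mod d"
  shows "inverse z ^ (k * j) * qbinomial z k j * qbinomial z (k + j) j
    = of_nat ((a choose b) * ((a + b) choose b))
      * (inverse z ^ (r * s) * qbinomial z r s * qbinomial z (r + s) s)"
proof -
  have rs: "r < d" "s < d" using d_gt_1 by (simp_all add: r_def s_def)
  have kj: "k + j = d * (a + b) + (r + s)"
    by (simp add: a_def b_def r_def s_def algebra_simps)
  have "z ^ (k * j) = z ^ (k * j mod d)" by (simp only: power_mod)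
  also have "\<dots> = z ^ (r * s mod d)" by (simp only: r_def s_def mod_mult_eq)
  also have "\<dots> = z ^ (r * s)" by (simp only: power_mod)
  finally have pow: "inverse z ^ (k * j) = inverse z ^ (r * s)" by (simp only: power_inverse)
  have "qbinomial z (k + j) j = of_nat ((a + b) choose b) * qbinomial z (r + s) s"
  proof (cases "r + s < d")
    case True
    then show ?thesis
      using d_gt_1 by (subst qLucas) (simp add: kj b_def s_def)
  next
    case False
    define t where "t = r + s - d"
    \<comment> \<open>After a carry the residue \<open>t\<close> is smaller than \<open>s\<close>,
      so both sides vanish by \<open>qLucas\<close>.\<close>
    have t: "r + s = d * 1 + t" "t < s" "t < d" using False rs by (auto simp: t_def)
    have "(r + s) mod d = t" using t by simp
    then have "qbinomial z (r + s) s = 0"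
      using t rs by (subst qLucas) (simp add: qbinomial_eq_0)
    moreover have "(k + j) mod d = t" using t unfolding kj by simp
    then have "qbinomial z (k + j) j = 0"
      using t by (subst qLucas) (simp add: qbinomial_eq_0 flip: s_def)
    ultimately show ?thesis by simp
  qed
  moreover have "qbinomial z k j = of_nat (a choose b) * qbinomial z r s"
    by (simp only: qLucas[of k] a_def b_def r_def s_def)
  ultimately show ?thesis by (simp add: pow)
qed

text \<open>Modulo \<open>d\<close> the reflection is r \<mapsto> -1 - r, so it swaps
  \<open>inverse z ^ r\<close> and \<open>z ^ Suc r\<close>.\<close>

lemma power_reflect:
  assumes "r < d"
  shows "inverse z ^ (d - Suc r) = z ^ Suc r" "z ^ Suc (d - Suc r) = inverse z ^ r"
proof -
  have "z ^ (d - Suc r) = inverse z ^ Suc r" using assms by (intro power_minus_index) auto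
  then show "inverse z ^ (d - Suc r) = z ^ Suc r" by (simp only: power_inverse inverse_inverse_eq)
  have "Suc (d - Suc r) = d - r" using assms by simp
  then show "z ^ Suc (d - Suc r) = inverse z ^ r"
    using assms by (simp only:) (intro power_minus_index, auto)
qed

text \<open>The product in \<open>qbinomial_pair_prod\<close> is symmetric in the two swapped
  powers, and its denominators can be cancelled since \<open>s < d\<close>.\<close>

lemma q_apery_coeff_reflect_small:
  assumes "r < d" "s < d"
  shows "inverse z ^ ((d - Suc r) * s) * qbinomial z (d - Suc r) s * qbinomial z (d - Suc r + s) s
       = inverse z ^ (r * s) * qbinomial z r s * qbinomial z (r + s) s" (is "?L = ?R")
proof -
  let ?D = "(\<Prod>i<s. 1 - z ^ Suc i)\<^sup>2"
  have "?L * ?D = ?R * ?D"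
    unfolding qbinomial_pair_prod[OF nonzero] power_reflect[OF assms(1)]
    by (simp only: add.commute)
  moreover have "?D \<noteq> 0" using prod_nonzero[OF assms(2)] by (rule power_not_zero)
  ultimately show ?thesis by (simp only: mult_cancel_right) blast
qed

text \<open>The ordinary binomials split off by \<open>q_apery_coeff_Lucas\<close> depend only on
  quotients by \<open>d\<close>, which the reflection preserves.\<close>

lemma q_apery_poly_reflect:
  assumes "d dvd N" "r < d" "a * d + d \<le> N" "\<alpha> > 0"
  shows "q_apery_poly N z \<alpha> (a * d + (d - Suc r)) = q_apery_poly N z \<alpha> (a * d + r)"
proof (rule poly_eqI)
  fix j
  have *: "(a * d + r) div d = a" "(a * d + r) mod d = r" if "r < d" for r
    using that by auto
  have s: "j mod d < d" using d_gt_1 by simp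
  have "d - Suc r < d" using assms(2) by simp
  then have "q_apery_coeff N z (a * d + (d - Suc r)) j = q_apery_coeff N z (a * d + r) j"
    using assms
    by (simp only: q_apery_coeff_conv q_apery_coeff_Lucas[of "_ + _" j] *
          q_apery_coeff_reflect_small[OF assms(2) s])
  then show "coeff (q_apery_poly N z \<alpha> (a * d + (d - Suc r))) j
      = coeff (q_apery_poly N z \<alpha> (a * d + r)) j"
    using assms(4) by (simp only: coeff_q_apery_poly)
qed

text \<open>The geometric sum telescopes to a difference of the two powers that the reflection
  swaps, which makes the weight antisymmetric.\<close>

lemma q_weight_conv:
  assumes "d dvd N" "k \<le> N"
  shows "(1 - z) * q_weight N z k = inverse z ^ k - z ^ Suc k"
proof -
  have "(1 - z) * q_weight N z k = inverse z ^ k * ((1 - z) * (\<Sum>i<2 * k + 1. z ^ i))"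
    by (simp only: q_weight_def power_minus_index[OF assms] mult_ac)
  also have "(1 - z) * (\<Sum>i<2 * k + 1. z ^ i) = 1 - z ^ (2 * k + 1)"
    by (rule one_diff_power_eq[symmetric])
  also have "inverse z ^ k * (1 - z ^ (2 * k + 1)) = inverse z ^ k - z ^ Suc k"
    by (simp add: field_simps power_add mult_2 mult_2_right power_inverse)
  finally show ?thesis .
qed

lemma q_weight_reflect:
  assumes "d dvd N" "r < d" "a * d + d \<le> N"
  shows "q_weight N z (a * d + (d - Suc r)) = - q_weight N z (a * d + r)"
proof -
  have ad: "z ^ (a * d + e) = z ^ e" "inverse z ^ (a * d + e) = inverse z ^ e" for e
    by (simp_all add: power_add power_inverse)
  have "(1 - z) * q_weight N z (a * d + (d - Suc r)) = z ^ Suc r - inverse z ^ r"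
    using assms by (subst q_weight_conv)
      (auto simp only: add_Suc_right[symmetric] ad power_reflect)
  also have "\<dots> = (1 - z) * (- q_weight N z (a * d + r))"
    using assms by (simp only: mult_minus_right, subst q_weight_conv)
      (auto simp only: add_Suc_right[symmetric] ad minus_diff_eq)
  finally show ?thesis
    using power_neq_1[of 1] d_gt_1 by (simp only: mult_cancel_left) auto
qed

text \<open>With \<open>e = l - k\<close>, the exponents differ by
  \<open>e * (2 * a + 1) * d / 2\<close>. For even \<open>e\<close> this is a multiple of
  \<open>d\<close>. For odd \<open>e\<close>, \<open>d\<close> is even and
  \<open>z ^ (d div 2) = - 1\<close> compensates the sign \<open>(- 1) ^ e\<close>.\<close>

lemma q_sign_eq:
  assumes "k + l + 1 = (2 * a + 1) * d" "k \<le> l"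
  shows "q_sign z l = q_sign z k"
proof -
  obtain e where l: "l = k + e" using assms(2) le_Suc_ex by blast
  have e: "2 * k + e + 1 = (2 * a + 1) * d" using assms(1) l by simp
  have "l * (l + 1) = k * (k + 1) + e * (2 * k + e + 1)" unfolding l by algebra
  then have tri: "l * (l + 1) = k * (k + 1) + e * ((2 * a + 1) * d)" by (simp only: e)
  show ?thesis
  proof (cases "even e")
    case True
    then obtain f where f: "e = 2 * f" by blast
    have "l * (l + 1) = k * (k + 1) + (f * (2 * a + 1) * d) * 2"
      unfolding tri f by (simp only: mult_ac)
    then have "l * (l + 1) div 2 = k * (k + 1) div 2 + f * (2 * a + 1) * d"
      by (simp only: div_mult_self1 zero_neq_numeral[symmetric] not_False_eq_True)
    then show ?thesis
      unfolding q_sign_def l f by (simp only: power_add power_mult_d) (simp add: power_mult)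
  next
    case False
    then have "even ((2 * a + 1) * d)" unfolding e[symmetric] by simp
    then obtain c where c: "d = 2 * c" by auto
    have "(z ^ c)\<^sup>2 = 1" using power_d unfolding c by (simp add: power_mult mult.commute)
    moreover have "z ^ c \<noteq> 1" using power_neq_1[of c] d_gt_1 c by simp
    ultimately have zc: "z ^ c = - 1" by (simp add: power2_eq_1_iff)
    have "l * (l + 1) = k * (k + 1) + (c * (e * (2 * a + 1))) * 2"
      unfolding tri c by (simp only: mult_ac)
    then have "l * (l + 1) div 2 = k * (k + 1) div 2 + c * (e * (2 * a + 1))"
      by (simp only: div_mult_self1 zero_neq_numeral[symmetric] not_False_eq_True)
    then have "z ^ (l * (l + 1) div 2) = z ^ (k * (k + 1) div 2) * (- 1) ^ (e * (2 * a + 1))"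
      by (simp only: power_add power_mult zc)
    then show ?thesis
      using False unfolding q_sign_def l by (simp add: power_add)
  qed
qed

lemma q_sign_reflect:
  assumes "r < d"
  shows "q_sign z (a * d + (d - Suc r)) = q_sign z (a * d + r)"
proof -
  have "(a * d + r) + (a * d + (d - Suc r)) + 1 = (2 * a + 1) * d"
    using assms by (simp add: algebra_simps)
  then show ?thesis
    using q_sign_eq[of "a * d + r" "a * d + (d - Suc r)" a]
      q_sign_eq[of "a * d + (d - Suc r)" "a * d + r" a]
    by (metis add.commute nat_le_linear)
qed

text \<open>The factor \<open>\<epsilon>\<close> is left abstract to cover both the constant 1 and
  \<open>q_sign\<close>. Each block sum equals its own negative, hence is zero over the complex
  numbers.\<close>

lemma q_sum_eq_0:
  assumes "d dvd N" "\<alpha> > 0"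
    and eps: "\<And>a r. r < d \<Longrightarrow> \<epsilon> (a * d + (d - Suc r)) = \<epsilon> (a * d + r)"
  shows "(\<Sum>k<N. [:\<epsilon> k:] * [:q_weight N z k:] * q_apery_poly N z \<alpha> k ^ m) = 0"
proof -
  define f where "f k = [:\<epsilon> k:] * [:q_weight N z k:] * q_apery_poly N z \<alpha> k ^ m" for k
  obtain M where N: "N = M * d" using assms(1) by (metis dvdE mult.commute)
  have block: "sum f {a * d..<a * d + d} = 0" if "a < M" for a
  proof -
    have "Suc a * d \<le> M * d" using that by (intro mult_right_mono) auto
    then have le: "a * d + d \<le> N" by (simp add: N)
    have anti: "f (a * d + (d - Suc r)) = - f (a * d + r)" if "r < d" for r
      unfolding f_def q_weight_reflect[OF assms(1) that le]
        q_apery_poly_reflect[OF assms(1) that le assms(2)] eps[OF that]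
      by simp
    have "sum f {a * d..<a * d + d} = (\<Sum>r<d. f (a * d + r))"
      by (simp add: sum.atLeastLessThan_shift_0 atLeast0LessThan)
    moreover have "(\<Sum>r<d. f (a * d + r)) = (\<Sum>r<d. f (a * d + (d - Suc r)))"
      by (rule sum.nat_diff_reindex[symmetric])
    moreover have "\<dots> = - (\<Sum>r<d. f (a * d + r))"
      unfolding sum_negf[symmetric] by (intro sum.cong refl anti) simp
    ultimately have "sum f {a * d..<a * d + d} + sum f {a * d..<a * d + d} = 0" by simp
    then show ?thesis by (simp flip: mult_2)
  qed
  have "sum f {..<N} = (\<Sum>a<M. sum f {a * d..<a * d + d})"
    by (simp add: N sum.nat_group)
  also have "\<dots> = 0" by (simp add: block)
  finally show ?thesis unfolding f_def .
qed

end

lemma primitive_root_exists: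
  fixes z :: complex
  assumes "z ^ n = 1" "z \<noteq> 1" "n > 0"
  obtains d where "primitive_root z d" "d dvd n"
proof
  define d where "d = (LEAST d. d > 0 \<and> z ^ d = 1)"
  have d: "d > 0" "z ^ d = 1"
    using LeastI[of "\<lambda>d. d > 0 \<and> z ^ d = 1" n] assms by (auto simp: d_def)
  have min: "z ^ i \<noteq> 1" if "0 < i" "i < d" for i
    using not_less_Least[of i "\<lambda>d. d > 0 \<and> z ^ d = 1"] that by (auto simp: d_def)
  have "d \<noteq> 1" using d assms by auto
  then show prim: "primitive_root z d"
    using d min by unfold_locales auto
  have "z ^ (n mod d) = 1"
    using assms(1) by (simp add: primitive_root.power_mod[OF prim])
  then have "\<not> 0 < n mod d" using min[of "n mod d"] d by auto
  then show "d dvd n" by (simp add: dvd_eq_mod_eq_0)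
qed

section \<open>From roots of unity to divisibility\<close>

text \<open>A property of functions, so that integrality follows from closure rules without writing
  down the polynomials in \<open>q\<close>.\<close>

definition int_polynomial_fun :: "(complex \<Rightarrow> complex) \<Rightarrow> bool" where
  "int_polynomial_fun f \<longleftrightarrow> (\<exists>P. (\<forall>i. coeff P i \<in> \<int>) \<and> (\<forall>q. f q = poly P q))"

lemma int_polynomial_fun_const: "c \<in> \<int> \<Longrightarrow> int_polynomial_fun (\<lambda>q. c)"
  unfolding int_polynomial_fun_def
  by (intro exI[of _ "[:c:]"]) (auto simp: coeff_pCons split: nat.split)

lemma int_polynomial_fun_id: "int_polynomial_fun (\<lambda>q. q)"
  unfolding int_polynomial_fun_def
  by (intro exI[of _ "[:0, 1:]"]) (auto simp: coeff_pCons split: nat.split)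

lemma int_polynomial_fun_add:
  "int_polynomial_fun f \<Longrightarrow> int_polynomial_fun g \<Longrightarrow> int_polynomial_fun (\<lambda>q. f q + g q)"
  unfolding int_polynomial_fun_def by (metis Ints_add coeff_add poly_add)

lemma int_polynomial_fun_mult:
  assumes "int_polynomial_fun f" "int_polynomial_fun g"
  shows "int_polynomial_fun (\<lambda>q. f q * g q)"
proof -
  obtain P Q where "\<forall>i. coeff P i \<in> \<int>" "\<forall>q. f q = poly P q"
    "\<forall>i. coeff Q i \<in> \<int>" "\<forall>q. g q = poly Q q"
    using assms unfolding int_polynomial_fun_def by blast
  then show ?thesis
    unfolding int_polynomial_fun_def
    by (intro exI[of _ "P * Q"]) (auto simp: coeff_mult intro!: Ints_sum Ints_mult)
qed

lemma int_polynomial_fun_power: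
  "int_polynomial_fun f \<Longrightarrow> int_polynomial_fun (\<lambda>q. f q ^ n)"
  by (induction n) (auto intro: int_polynomial_fun_const int_polynomial_fun_mult)

lemma int_polynomial_fun_sum:
  "(\<And>i. i \<in> A \<Longrightarrow> int_polynomial_fun (f i)) \<Longrightarrow> int_polynomial_fun (\<lambda>q. \<Sum>i\<in>A. f i q)"
  by (induction A rule: infinite_finite_induct)
    (auto intro: int_polynomial_fun_const int_polynomial_fun_add)

lemma int_polynomial_fun_qbinomial: "int_polynomial_fun (\<lambda>q. qbinomial q n j)"
proof (induction n arbitrary: j)
  case 0
  show ?case by (cases j) (auto intro: int_polynomial_fun_const)
next
  case (Suc n)
  show ?case
    by (cases j) (auto simp del: power_Suc intro!: int_polynomial_fun_const Suc.IH
        int_polynomial_fun_add int_polynomial_fun_mult int_polynomial_fun_power int_polynomial_fun_id)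
qed

lemmas int_polynomial_fun_intros =
  int_polynomial_fun_const int_polynomial_fun_id int_polynomial_fun_mult
  int_polynomial_fun_power int_polynomial_fun_sum int_polynomial_fun_qbinomial

text \<open>Since \<open>M\<close> has constant term 1, the coefficients of \<open>Q\<close> can be
  solved for successively, from the lowest upwards, without division.\<close>

lemma Ints_coeff_quotient:
  fixes M Q :: "complex poly"
  assumes M: "\<And>i. coeff M i \<in> \<int>" and MQ: "\<And>i. coeff (M * Q) i \<in> \<int>"
    and M0: "coeff M 0 = 1"
  shows "coeff Q i \<in> \<int>"
proof (induction i rule: less_induct)
  case (less i)
  have "coeff (M * Q) i = (\<Sum>j\<le>i. coeff M j * coeff Q (i - j))"
    by (rule coeff_mult)
  also have "\<dots> = coeff Q i + (\<Sum>j\<in>{..i} - {0}. coeff M j * coeff Q (i - j))"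
    by (subst sum.remove[of _ 0]) (auto simp: M0)
  finally have "coeff Q i = coeff (M * Q) i - (\<Sum>j\<in>{..i} - {0}. coeff M j * coeff Q (i - j))"
    by simp
  also have "\<dots> \<in> \<int>"
    by (intro Ints_diff MQ Ints_sum Ints_mult M less) auto
  finally show ?case .
qed

text \<open>\<open>P\<close> is divisible by \<open>M\<close>, which is 1 + q + ... + q^(n-1), with
  a quotient over the integers; evaluation at 1, where \<open>M\<close> takes the value
  \<open>n\<close>, gives the claim.\<close>

lemma dvd_of_vanishing_at_roots_of_unity:
  fixes P :: "complex poly"
  assumes "n > 0" and "\<And>i. coeff P i \<in> \<int>"
    and zero: "\<And>z. z ^ n = 1 \<Longrightarrow> z \<noteq> 1 \<Longrightarrow> poly P z = 0"
    and c: "poly P 1 = of_int c"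
  shows "int n dvd c"
proof -
  define M :: "complex poly" where "M = (\<Sum>i<n. monom 1 i)"
  have coeff_M: "coeff M i = (if i < n then 1 else 0)" for i
    by (simp add: M_def coeff_sum)
  have poly_M: "poly M x = (\<Sum>i<n. x ^ i)" for x
    by (simp add: M_def poly_sum poly_monom)
  have M0: "M \<noteq> 0" using coeff_M[of 0] assms(1) by auto
  have "degree M \<le> n - 1" by (rule degree_le) (auto simp: coeff_M)
  have M_root: "poly M z = 0" if "z ^ n = 1" "z \<noteq> 1" for z
    using that by (simp add: poly_M geometric_sum)
  \<comment> \<open>A nonzero remainder would have \<open>n - 1\<close> roots but degree below
    \<open>n - 1\<close>.\<close>
  have R: "P mod M = 0"
  proof (rule ccontr)
    assume nz: "P mod M \<noteq> 0"
    have root: "poly (P mod M) z = 0" if "z ^ n = 1" "z \<noteq> 1" for z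
    proof -
      have "poly P z = poly (M * (P div M) + P mod M) z" by simp
      then show ?thesis using M_root[OF that] zero[OF that]
        by (simp only: poly_add poly_mult) simp
    qed
    have "n - 1 = card ({z::complex. z ^ n = 1} - {1})"
      using card_roots_unity_eq[OF assms(1)] by (subst card_Diff_singleton) auto
    also have "\<dots> \<le> card {z. poly (P mod M) z = 0}"
      using root by (intro card_mono poly_roots_finite nz) auto
    also have "\<dots> \<le> degree (P mod M)" by (rule card_poly_roots_bound[OF nz])
    also have "\<dots> < degree M" by (rule degree_mod_less'[OF M0 nz])
    finally show False using \<open>degree M \<le> n - 1\<close> by simp
  qed
  then obtain Q where Q: "P = M * Q" by (meson dvdE mod_0_imp_dvd)
  have "coeff Q i \<in> \<int>" for i
    by (rule Ints_coeff_quotient[of M Q]) (use assms Q in \<open>auto simp: coeff_M\<close>)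
  then have "poly Q 1 \<in> \<int>" by (auto simp: poly_altdef intro: Ints_sum)
  then obtain b where b: "poly Q 1 = of_int b" by (elim Ints_cases)
  have "of_int c = (of_int (int n * b) :: complex)"
    using c by (simp add: Q poly_M b)
  then show ?thesis by (simp only: of_int_eq_iff) simp
qed

text \<open>The variable of the polynomials \<open>h q\<close> is \<open>x\<close>.\<close>

definition q_analogue :: "(complex \<Rightarrow> complex poly) \<Rightarrow> int poly \<Rightarrow> bool" where
  "q_analogue h t \<longleftrightarrow> (\<forall>i. int_polynomial_fun (\<lambda>q. coeff (h q) i)) \<and>
     (\<forall>i. coeff (h 1) i = of_int (coeff t i))"

section \<open>Closure properties of q-analogues\<close>

lemma q_analogue_monom:
  assumes "int_polynomial_fun f" "f 1 = of_int c"
  shows "q_analogue (\<lambda>q. monom (f q) j) (monom c j)"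
proof -
  have "int_polynomial_fun (\<lambda>q. coeff (monom (f q) j) i)" for i
    using assms(1) by (cases "i = j") (auto intro: int_polynomial_fun_const)
  then show ?thesis using assms(2) by (simp add: q_analogue_def)
qed

lemma q_analogue_const:
  "int_polynomial_fun f \<Longrightarrow> f 1 = of_int c \<Longrightarrow> q_analogue (\<lambda>q. [:f q:]) [:c:]"
  using q_analogue_monom[of f c 0] by (simp add: monom_0)

lemma q_analogue_add:
  "q_analogue h t \<Longrightarrow> q_analogue h' t' \<Longrightarrow> q_analogue (\<lambda>q. h q + h' q) (t + t')"
  by (auto simp: q_analogue_def intro: int_polynomial_fun_add)

lemma q_analogue_mult:
  "q_analogue h t \<Longrightarrow> q_analogue h' t' \<Longrightarrow> q_analogue (\<lambda>q. h q * h' q) (t * t')"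
  by (auto simp: q_analogue_def coeff_mult intro!: int_polynomial_fun_sum int_polynomial_fun_mult)

lemma q_analogue_power: "q_analogue h t \<Longrightarrow> q_analogue (\<lambda>q. h q ^ m) (t ^ m)"
proof (induction m)
  case 0
  show ?case using q_analogue_const[of "\<lambda>q. 1" 1]
    by (simp add: int_polynomial_fun_const one_pCons)
qed (auto intro: q_analogue_mult)

lemma q_analogue_sum:
  "(\<And>i. i \<in> A \<Longrightarrow> q_analogue (h i) (t i)) \<Longrightarrow> q_analogue (\<lambda>q. \<Sum>i\<in>A. h i q) (\<Sum>i\<in>A. t i)"
proof (induction A rule: infinite_finite_induct)
  case (insert x A)
  then show ?case by (simp add: q_analogue_add)
qed (auto simp: q_analogue_def intro: int_polynomial_fun_const)

lemma q_analogue_apery: "q_analogue (\<lambda>q. q_apery_poly N q \<alpha> k) (apery_poly \<alpha> k)"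
  unfolding q_apery_poly_def apery_poly_def q_apery_coeff_def
  by (intro q_analogue_sum q_analogue_monom int_polynomial_fun_intros)
    (simp add: qbinomial_one power_mult_distrib)

lemma q_analogue_weight: "q_analogue (\<lambda>q. [:q_weight N q k:]) (of_nat (2 * k + 1))"
  unfolding of_nat_poly q_weight_def
  by (intro q_analogue_const int_polynomial_fun_intros) simp

lemma q_analogue_sign: "q_analogue (\<lambda>q. [:q_sign q k:]) ((- 1) ^ k)"
proof -
  have "(- 1) ^ k = [:(- 1) ^ k :: int:]"
    by (simp add: one_pCons poly_const_pow)
  then show ?thesis
    unfolding q_sign_def by (auto intro!: q_analogue_const int_polynomial_fun_intros)
qed

text \<open>Each coefficient in x is an integer polynomial in \<open>q\<close>, to which the
  divisibility criterion applies separately.\<close>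

lemma poly_cong_of_q_analogue:
  assumes "n > 0" and h: "q_analogue h t"
    and zero: "\<And>z. z ^ n = 1 \<Longrightarrow> z \<noteq> 1 \<Longrightarrow> h z = 0"
  shows "poly_cong t 0 n"
  unfolding poly_cong_def
proof
  fix i
  obtain P where P: "\<And>i. coeff P i \<in> \<int>" "\<And>q. coeff (h q) i = poly P q"
    using h unfolding q_analogue_def int_polynomial_fun_def by metis
  have "int n dvd coeff t i"
    using assms(1) P(1)
  proof (rule dvd_of_vanishing_at_roots_of_unity)
    show "poly P z = 0" if "z ^ n = 1" "z \<noteq> 1" for z
      using zero[OF that] by (simp flip: P(2))
    show "poly P 1 = of_int (coeff t i)"
      using h by (simp add: q_analogue_def flip: P(2))
  qed
  then show "int n dvd coeff (t - 0) i" by simp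
qed

lemma poly_cong_weighted_sum:
  fixes \<epsilon> :: "complex \<Rightarrow> nat \<Rightarrow> complex"
  assumes "n > 0" "\<alpha> > 0"
    and "\<And>k. q_analogue (\<lambda>q. [:\<epsilon> q k:]) (e k)"
    and "\<And>z d a r. primitive_root z d \<Longrightarrow> r < d \<Longrightarrow> \<epsilon> z (a * d + (d - Suc r)) = \<epsilon> z (a * d + r)"
  shows "poly_cong (\<Sum>k<n. e k * of_nat (2 * k + 1) * apery_poly \<alpha> k ^ m) 0 n"
  using assms(1)
proof (rule poly_cong_of_q_analogue)
  \<comment> \<open>The choice \<open>N = n\<close> is a multiple of the order of every
    \<open>n\<close>-th root of unity, so one q-analogue serves all of them.\<close>
  show "q_analogue (\<lambda>q. \<Sum>k<n. [:\<epsilon> q k:] * [:q_weight n q k:] * q_apery_poly n q \<alpha> k ^ m)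
      (\<Sum>k<n. e k * of_nat (2 * k + 1) * apery_poly \<alpha> k ^ m)"
    by (intro q_analogue_sum q_analogue_mult q_analogue_power q_analogue_apery
        q_analogue_weight assms(3))
  show "(\<Sum>k<n. [:\<epsilon> z k:] * [:q_weight n z k:] * q_apery_poly n z \<alpha> k ^ m) = 0"
    if z: "z ^ n = 1" "z \<noteq> 1" for z
  proof -
    obtain d where d: "primitive_root z d" "d dvd n"
      using primitive_root_exists[OF z assms(1)] by blast
    show ?thesis
      by (rule primitive_root.q_sum_eq_0[OF d assms(2) assms(4)[OF d(1)]])
  qed
qed

theorem theorem1:
  fixes m \<alpha> n :: nat
  assumes "m > 0" and "\<alpha> > 0" and "n > 0"
  shows "poly_cong (\<Sum>k<n. of_nat (2 * k + 1) * apery_poly \<alpha> k ^ m) 0 n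
       \<and> poly_cong (\<Sum>k<n. (- 1) ^ k * of_nat (2 * k + 1) * apery_poly \<alpha> k ^ m) 0 n"
proof
  have "q_analogue (\<lambda>q. [:1:]) 1"
    using q_analogue_const[of "\<lambda>q. 1" 1] by (simp add: int_polynomial_fun_const one_pCons)
  then show "poly_cong (\<Sum>k<n. of_nat (2 * k + 1) * apery_poly \<alpha> k ^ m) 0 n"
    using poly_cong_weighted_sum[of n \<alpha> "\<lambda>_ _. 1" "\<lambda>_. 1" m] assms by simp
  show "poly_cong (\<Sum>k<n. (- 1) ^ k * of_nat (2 * k + 1) * apery_poly \<alpha> k ^ m) 0 n"
    by (rule poly_cong_weighted_sum[OF assms(3,2) q_analogue_sign primitive_root.q_sign_reflect])
qed

end
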